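(* Let $\mathcal{H}$ be a finite-dimensional Hilbert space, let $\mathcal{U}$ be a unitary on $\mathcal{H}$, and let $\widetilde{\mathcal{U}}$ be the unitary on $\mathcal{H}$ induced by an optimistic quantum circuit for $\mathcal{U}$ with error parameter $\epsilon$, i.e. $\|\widetilde{\mathcal{U}}-\mathcal{U}\|_F^2/\dim\mathcal{H}\le\epsilon$. Let $d$ be a unitary 1-design on $\mathcal{H}$. Then for every state (unit vector) $|\psi\rangle\in\mathcal{H}$, $$\mathop{\mathbb{E}}_{V\sim d}\left[\,\big\|\hat V^\dagger\,\widetilde{\mathcal{U}}\,V|\psi\rangle-\mathcal{U}|\psi\rangle\big\|^2\,\right]\le\epsilon ,$$ where, for each $V$, $\hat V=\mathcal{U}V\mathcal{U}^\dagger$, and $\mathbb{E}_{V\sim d}$ denotes the expectation over unitaries $V$ drawn from $d$.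
   Context: $\|A\|_F^2=\mathrm{Tr}[A^\dagger A]$ is the squared Frobenius norm. A quantum circuit inducing a unitary $\widetilde{\mathcal{U}}$ on $\mathcal{H}$ is an optimistic quantum circuit for $\mathcal{U}$ with error parameter $\epsilon$ if $\|\widetilde{\mathcal{U}}-\mathcal{U}\|_F^2/\dim\mathcal{H}\le\epsilon$ (equivalently, for any orthonormal basis $\{|\phi_i\rangle\}$ of $\mathcal{H}$, $\frac{1}{\dim\mathcal{H}}\sum_i\|\widetilde{\mathcal{U}}|\phi_i\rangle-\mathcal{U}|\phi_i\rangle\|^2\le\epsilon$). A unitary 1-design on $\mathcal{H}$ is an ensemble of unitaries $\{V_i\}$ on $\mathcal{H}$ with probabilities $p_i$ such that for every operator $X$ on $\mathcal{H}$, $\sum_i p_iV_iXV_i^\dagger=\mathbb{I}\cdot\mathrm{Tr}[X]/\dim\mathcal{H}$. *)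

theory Defs
  imports "HOL-Analysis.Analysis" "HOL-Probability.Probability"
begin

text \<open>
  Operators on an \<open>n\<close>-dimensional Hilbert space are matrices of type \<^typ>\<open>complex^'n^'n\<close> with
  respect to an orthonormal basis indexed by \<open>'n\<close>; the dimension is \<open>CARD('n)\<close>. On
  \<^typ>\<open>complex^'n\<close> the library norm is the Hilbert space norm.
\<close>

definition dagger :: "complex^'n^'m \<Rightarrow> complex^'m^'n"
  where "dagger A = (\<chi> i j. cnj (A $ j $ i))"

definition unitary_matrix :: "complex^'n^'n \<Rightarrow> bool"
  where "unitary_matrix U \<longleftrightarrow> dagger U ** U = mat 1 \<and> U ** dagger U = mat 1"

text \<open>The trace of \<open>dagger A ** A\<close> is real and nonnegative; \<^const>\<open>Re\<close> only changes the type.\<close>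

definition frobenius_sq :: "complex^'n^'n \<Rightarrow> real"
  where "frobenius_sq A = Re (trace (dagger A ** A))"

text \<open>A circuit enters only through the unitary that it induces.\<close>

definition optimistic_for :: "real \<Rightarrow> complex^'n^'n \<Rightarrow> complex^'n^'n \<Rightarrow> bool"
  where "optimistic_for \<epsilon> U' U \<longleftrightarrow>
    unitary_matrix U' \<and> frobenius_sq (U' - U) / real CARD('n) \<le> \<epsilon>"

text \<open>
  The ensemble consists of the unitaries \<open>V i\<close>, drawn with probability \<open>pmf p i\<close>; it may be finite
  or countably infinite, and distinct indices may carry the same unitary. As the unitaries are
  bounded, the integrand below is always integrable, so the expectation is the (absolutely
  convergent) sum of the terms \<open>pmf p i *\<^sub>R (V i ** X ** dagger (V i))\<close>. The matrix \<open>mat c\<close> is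
  \<open>c\<close> times the identity.
\<close>

definition unitary_1_design :: "'i pmf \<Rightarrow> ('i \<Rightarrow> complex^'n^'n) \<Rightarrow> bool"
  where "unitary_1_design p V \<longleftrightarrow>
    (\<forall>i\<in>set_pmf p. unitary_matrix (V i)) \<and>
    (\<forall>X :: complex^'n^'n.
      measure_pmf.expectation p (\<lambda>i. V i ** X ** dagger (V i)) =
      mat (trace X / of_nat CARD('n)))"

end

theory Submission imports Defs begin

text \<open>
  Left multiplication by the unitary \<open>V_hat\<close> turns the error for a fixed \<open>V\<close> into
  \<open>\<parallel>(U' - U) V \<psi>\<parallel>\<^sup>2 = Tr[(U' - U) (V \<psi> \<psi>\<^sup>\<dagger> V\<^sup>\<dagger>) (U' - U)\<^sup>\<dagger>]\<close>. The right-hand side is linear in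
  \<open>V \<psi> \<psi>\<^sup>\<dagger> V\<^sup>\<dagger>\<close>, whose expectation over a 1-design is the maximally mixed state, so the expected
  error is exactly \<open>\<parallel>U' - U\<parallel>\<^sub>F\<^sup>2\<close> divided by the dimension.
\<close>

definition rank_one :: "complex^'n \<Rightarrow> complex^'n^'n"
  where "rank_one x = (\<chi> i j. x $ i * cnj (x $ j))"

lemma dagger_dagger [simp]: "dagger (dagger A) = A"
  by (simp add: dagger_def vec_eq_iff)

lemma dagger_matrix_mult: "dagger (A ** B) = dagger B ** dagger A"
  by (simp add: dagger_def matrix_matrix_mult_def vec_eq_iff mult.commute)

lemma unitary_matrix_dagger: "unitary_matrix U \<Longrightarrow> unitary_matrix (dagger U)"
  by (simp add: unitary_matrix_def)

lemma unitary_matrix_mult: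
  assumes "unitary_matrix U" "unitary_matrix W"
  shows "unitary_matrix (U ** W)"
proof -
  have "dagger (U ** W) ** (U ** W) = dagger W ** (dagger U ** U) ** W"
    and "(U ** W) ** dagger (U ** W) = U ** (W ** dagger W) ** dagger U"
    by (simp_all add: dagger_matrix_mult matrix_mul_assoc)
  then show ?thesis
    using assms by (simp add: unitary_matrix_def)
qed

lemma trace_rank_one: "trace (rank_one x) = of_real ((norm x)\<^sup>2)"
  by (simp add: trace_def rank_one_def norm_vec_def L2_set_def sum_nonneg
      flip: complex_norm_square)

lemma rank_one_matrix_vector_mult: "rank_one (A *v x) = A ** rank_one x ** dagger A"
  by (simp add: rank_one_def dagger_def matrix_matrix_mult_def matrix_vector_mult_def vec_eq_iff
      sum_distrib_left sum_distrib_right mult_ac)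

text \<open>The left side is quadratic in \<open>x\<close>, but the right side is linear in
  \<open>rank_one x\<close>; this linearity is what lets an expectation pass inside.\<close>

lemma norm_sq_matrix_vector_mult:
  "(norm (A *v x))\<^sup>2 = Re (trace (A ** rank_one x ** dagger A))"
  by (simp add: trace_rank_one flip: rank_one_matrix_vector_mult)

text \<open>Cyclicity of the trace brings \<open>dagger W\<close> next to \<open>W\<close>, where
  they cancel.\<close>

lemma norm_unitary_matrix_vector_mult:
  assumes "unitary_matrix W"
  shows "norm (W *v x) = norm x"
proof -
  have "trace (W ** rank_one x ** dagger W) = trace (dagger W ** W ** rank_one x)"
    by (metis trace_mul_sym matrix_mul_assoc)
  then have "(norm (W *v x))\<^sup>2 = (norm x)\<^sup>2"
    using assms by (simp add: norm_sq_matrix_vector_mult unitary_matrix_def trace_rank_one)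
  then show ?thesis
    by simp
qed

text \<open>Boundedness, automatic in finite dimension, is what permits exchanging the map with the
  Bochner integral.\<close>

lemma bounded_linear_Re_trace_conjugation:
  fixes A :: "complex^'n^'n"
  shows "bounded_linear (\<lambda>M. Re (trace (A ** M ** dagger A)))"
proof -
  have "linear (\<lambda>M. Re (trace (A ** M ** dagger A)))"
  proof (rule linearI)
    show "Re (trace (A ** (M + N) ** dagger A))
        = Re (trace (A ** M ** dagger A)) + Re (trace (A ** N ** dagger A))" for M N
      by (simp add: trace_def matrix_matrix_mult_def ring_distribs sum.distrib)
    show "Re (trace (A ** (r *\<^sub>R M) ** dagger A)) = r *\<^sub>R Re (trace (A ** M ** dagger A))" for r M
      by (simp add: trace_def matrix_matrix_mult_def flip: scaleR_sum_right)
  qed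
  then show ?thesis
    by (simp add: linear_conv_bounded_linear)
qed

lemma unitary_1_design_integrable:
  fixes V :: "'i \<Rightarrow> complex^'n^'n"
  assumes "unitary_1_design p V" "trace X \<noteq> 0"
  shows "integrable p (\<lambda>i. V i ** X ** dagger (V i))"
proof (rule ccontr)
  \<comment> \<open>The integral of a non-integrable function is \<open>0\<close>, unlike the value demanded of a 1-design.\<close>
  assume "\<not> ?thesis"
  then have "measure_pmf.expectation p (\<lambda>i. V i ** X ** dagger (V i)) = 0"
    by (rule not_integrable_integral_eq)
  then have "mat (trace X / of_nat CARD('n)) = (0 :: complex^'n^'n)"
    using assms(1) by (simp add: unitary_1_design_def)
  \<comment> \<open>A diagonal entry on the left is the trace of \<open>X\<close> over the
    dimension, which is nonzero.\<close>
  then have "mat (trace X / of_nat CARD('n)) $ i $ i = (0 :: complex^'n^'n) $ i $ i" for i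
    by simp
  then show False
    using assms(2) by (simp add: mat_def)
qed

lemma unitary_1_design_expectation_norm_sq:
  fixes A :: "complex^'n^'n" and V :: "'i \<Rightarrow> complex^'n^'n"
  assumes "unitary_1_design p V" "norm \<psi> = 1"
  shows "measure_pmf.expectation p (\<lambda>i. (norm (A *v (V i *v \<psi>)))\<^sup>2)
    = frobenius_sq A / real CARD('n)"
proof -
  let ?T = "\<lambda>M. Re (trace (A ** M ** dagger A))"
  let ?F = "\<lambda>i. V i ** rank_one \<psi> ** dagger (V i)"
  have tr: "trace (rank_one \<psi>) = 1"
    using assms(2) by (simp add: trace_rank_one)
  have "measure_pmf.expectation p (\<lambda>i. (norm (A *v (V i *v \<psi>)))\<^sup>2)
      = measure_pmf.expectation p (\<lambda>i. ?T (?F i))"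
    by (simp only: norm_sq_matrix_vector_mult rank_one_matrix_vector_mult)
  also have "\<dots> = ?T (measure_pmf.expectation p ?F)"
    using unitary_1_design_integrable[OF assms(1)] tr
    by (intro integral_bounded_linear bounded_linear_Re_trace_conjugation) simp
  also have "\<dots> = ?T (mat (1 / of_nat CARD('n)))"
    using assms(1) tr by (simp add: unitary_1_design_def)
  \<comment> \<open>Because of \<open>Re\<close>, the map \<open>?T\<close> is linear over the reals
    only, so the scalar is first made real.\<close>
  also have "\<dots> = ?T ((1 / real CARD('n)) *\<^sub>R mat 1)"
    by (rule arg_cong[where f = ?T])
      (simp add: mat_def vec_eq_iff scaleR_conv_of_real[where 'a = complex])
  also have "\<dots> = (1 / real CARD('n)) *\<^sub>R ?T (mat 1)"
    by (rule linear_scale[OF bounded_linear.linear[OF bounded_linear_Re_trace_conjugation]])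
  also have "\<dots> = frobenius_sq A / real CARD('n)"
    by (simp add: frobenius_sq_def trace_mul_sym[of A])
  finally show ?thesis .
qed

theorem theorem1:
  fixes U U' :: "complex^'n^'n"
    and p :: "'i pmf" and V :: "'i \<Rightarrow> complex^'n^'n"
    and \<psi> :: "complex^'n" and \<epsilon> :: real
  assumes "unitary_matrix U"
    and "optimistic_for \<epsilon> U' U"
    and "unitary_1_design p V"
    and "norm \<psi> = 1"
  shows "measure_pmf.expectation p
    (\<lambda>i. let V_hat = U ** V i ** dagger U
         in (norm (dagger V_hat *v (U' *v (V i *v \<psi>)) - U *v \<psi>))\<^sup>2) \<le> \<epsilon>"
proof -
  have error: "norm (dagger (U ** V i ** dagger U) *v (U' *v (V i *v \<psi>)) - U *v \<psi>)
      = norm ((U' - U) *v (V i *v \<psi>))" if "i \<in> set_pmf p" for i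
  proof -
    define W where "W = dagger (U ** V i ** dagger U)"
    have V: "unitary_matrix (V i)"
      using assms(3) that by (simp add: unitary_1_design_def)
    have W: "unitary_matrix W"
      unfolding W_def by (intro unitary_matrix_dagger unitary_matrix_mult assms(1) V)
    \<comment> \<open>\<open>W\<close> equals \<open>U ** dagger (V i) ** dagger U\<close>, so it
      undoes \<open>V i\<close> after \<open>U\<close> has acted. Hence \<open>U *v \<psi>\<close>
      can be written as \<open>W\<close> applied to a vector, and \<open>W\<close> factors out of
      the difference.\<close>
    have "W ** U ** V i = U ** (dagger (V i) ** (dagger U ** U) ** V i)"
      by (simp add: W_def dagger_matrix_mult matrix_mul_assoc)
    also have "\<dots> = U"
      using assms(1) V by (simp add: unitary_matrix_def)
    finally have "W *v (U *v (V i *v \<psi>)) = U *v \<psi>"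
      by (simp add: matrix_vector_mul_assoc matrix_mul_assoc)
    then have "W *v (U' *v (V i *v \<psi>)) - U *v \<psi> = W *v ((U' - U) *v (V i *v \<psi>))"
      by (simp add: matrix_vector_mult_diff_rdistrib matrix_vector_mult_diff_distrib)
    then show ?thesis
      using norm_unitary_matrix_vector_mult[OF W] by (simp add: W_def)
  qed
  have "measure_pmf.expectation p
      (\<lambda>i. let V_hat = U ** V i ** dagger U
           in (norm (dagger V_hat *v (U' *v (V i *v \<psi>)) - U *v \<psi>))\<^sup>2)
    = measure_pmf.expectation p (\<lambda>i. (norm ((U' - U) *v (V i *v \<psi>)))\<^sup>2)"
    \<comment> \<open>The integrands are only known to agree on the support of \<open>p\<close>,
      where \<open>V i\<close> is unitary.\<close>
    by (intro integral_cong_AE) (auto simp: AE_measure_pmf_iff error)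
  also have "\<dots> = frobenius_sq (U' - U) / real CARD('n)"
    using assms(3,4) by (rule unitary_1_design_expectation_norm_sq)
  also have "\<dots> \<le> \<epsilon>"
    using assms(2) by (simp add: optimistic_for_def)
  finally show ?thesis .
qed

end
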